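(* Let $p,r\ge 1$ and let $\mathcal S=(S_n)_{n\ge 0}$ be a linearly recursive matrix sequence in $\mathcal M_p(\mathbb R)$ of order $r$ whose minimal polynomial $P_{\mathcal S}$ has real distinct roots. The following statements are equivalent: (1) $\mathcal S$ is a Hamburger matrix moment sequence; (2) $H_{r-1}:=(S_{i+j})_{0\le i,j\le r-1}\succeq 0$.
   Context: $\mathcal M_p(\mathbb R)$ is the algebra of real $p\times p$ matrices. For a real square matrix $M$, $M\succeq 0$ means $M$ is symmetric positive semidefinite. A sequence $\mathcal S=(S_n)_{n\ge 0}$ in $\mathcal M_p(\mathbb R)$ is a linearly recursive matrix sequence if there are an integer $m\ge 1$ and real numbers $a_0,\dots,a_{m-1}$ with $a_{m-1}\ne 0$ such that $S_{n+1}=a_0S_n+a_1S_{n-1}+\dots+a_{m-1}S_{n-m+1}$ for all $n\ge m-1$. Every polynomial $X^m-a_0X^{m-1}-\dots-a_{m-1}$ arising from such a recurrence (for any admissible $m$) satisfied by $\mathcal S$ is called a characteristic polynomial of $\mathcal S$. The linear span of all characteristic polynomials of $\mathcal S$ is an ideal of $\mathbb R[X]$; the minimal polynomial $P_{\mathcal S}$ is its unique monic generator, and $\mathcal S$ has order $r$ if $\deg P_{\mathcal S}=r$. "Real distinct roots" means all complex roots are real and simple. A matrix measure is a map $\mu=(\mu_{ij})_{1\le i,j\le p}$ on the Borel sets of $\mathbb R$, with entries finite signed measures, such that $\mu(B)$ is symmetric positive semidefinite for every Borel $B$. $\mathcal S$ is a Hamburger matrix moment sequence if there is a matrix measure $\mu$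 on $\mathbb R$ with $S_k=\int_{\mathbb R}x^k\,d\mu(x)$ (entrywise integral) for every $k\ge 0$. *)

theory Defs
  imports "HOL-Analysis.Analysis" "HOL-Computational_Algebra.Polynomial"
begin

section \<open>Linearly recursive matrix sequences\<close>

text \<open>
  Matrices are of type \<^typ>\<open>real^'p^'p\<close>, so the size is \<open>CARD('p) \<ge> 1\<close>.
\<close>

definition satisfies_recurrence ::
    "(nat \<Rightarrow> real^'p^'p) \<Rightarrow> nat \<Rightarrow> (nat \<Rightarrow> real) \<Rightarrow> bool" where
  "satisfies_recurrence S m a \<longleftrightarrow>
     m \<ge> 1 \<and> a (m - 1) \<noteq> 0 \<and>
     (\<forall>n\<ge>m - 1. S (n + 1) = (\<Sum>i<m. a i *\<^sub>R S (n - i)))"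

definition linearly_recursive :: "(nat \<Rightarrow> real^'p^'p) \<Rightarrow> bool" where
  "linearly_recursive S \<longleftrightarrow> (\<exists>m a. satisfies_recurrence S m a)"

definition characteristic_polys :: "(nat \<Rightarrow> real^'p^'p) \<Rightarrow> real poly set" where
  "characteristic_polys S =
     {monom 1 m - (\<Sum>i<m. monom (a i) (m - 1 - i)) | m a. satisfies_recurrence S m a}"

definition is_minimal_poly :: "(nat \<Rightarrow> real^'p^'p) \<Rightarrow> real poly \<Rightarrow> bool" where
  "is_minimal_poly S P \<longleftrightarrow>
     lead_coeff P = 1 \<and> module.span smult (characteristic_polys S) = {Q. P dvd Q}"

definition minimal_poly :: "(nat \<Rightarrow> real^'p^'p) \<Rightarrow> real poly" where
  "minimal_poly S = (THE P. is_minimal_poly S P)"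

definition has_order :: "(nat \<Rightarrow> real^'p^'p) \<Rightarrow> nat \<Rightarrow> bool" where
  "has_order S r \<longleftrightarrow> degree (minimal_poly S) = r"

definition real_distinct_roots :: "real poly \<Rightarrow> bool" where
  "real_distinct_roots P \<longleftrightarrow>
     (\<forall>z::complex. poly (map_poly of_real P) z = 0 \<longrightarrow>
        z \<in> \<real> \<and> order z (map_poly of_real P) = 1)"

section \<open>Positive semidefiniteness\<close>

text \<open>
  A real square matrix is given by its entries over a finite index set \<open>I\<close>; this covers both
  \<^typ>\<open>real^'p^'p\<close> and block matrices whose number of blocks is a natural number.
\<close>

definition psd_on :: "'i set \<Rightarrow> ('i \<Rightarrow> 'i \<Rightarrow> real) \<Rightarrow> bool" where
  "psd_on I M \<longleftrightarrow>
     (\<forall>i\<in>I. \<forall>j\<in>I. M i j = M j i) \<and>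
     (\<forall>x. 0 \<le> (\<Sum>i\<in>I. \<Sum>j\<in>I. x i * M i j * x j))"

text \<open>
  The entry of a block Hankel matrix at row \<open>(a, i)\<close> and column \<open>(b, j)\<close> is the \<open>(i, j)\<close> entry of
  the block in block row \<open>a\<close> and block column \<open>b\<close>. The matrix with blocks \<open>0, \<dots>, n\<close> is its
  restriction to the index set \<open>{0..n} \<times> UNIV\<close>.
\<close>

definition block_hankel :: "(nat \<Rightarrow> real^'p^'p) \<Rightarrow> nat \<times> 'p \<Rightarrow> nat \<times> 'p \<Rightarrow> real" where
  "block_hankel S = (\<lambda>(a, i) (b, j). S (a + b) $ i $ j)"

section \<open>Matrix measures and the Hamburger moment problem\<close>

text \<open>
  Signed measures are set functions of which only the values on Borel sets matter. The integral
  against a signed measure is taken over its Jordan decomposition, and the integrand has to be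
  integrable with respect to both parts, that is, with respect to the total variation.
\<close>

definition finite_signed_measure :: "(real set \<Rightarrow> real) \<Rightarrow> bool" where
  "finite_signed_measure \<nu> \<longleftrightarrow>
     \<nu> {} = 0 \<and>
     (\<forall>A::nat \<Rightarrow> real set. range A \<subseteq> sets borel \<longrightarrow> disjoint_family A \<longrightarrow>
        (\<lambda>n. \<nu> (A n)) sums \<nu> (\<Union>n. A n))"

definition jordan_decomposition ::
    "(real set \<Rightarrow> real) \<Rightarrow> real measure \<Rightarrow> real measure \<Rightarrow> bool" where
  "jordan_decomposition \<nu> M N \<longleftrightarrow>
     finite_measure M \<and> finite_measure N \<and> sets M = sets borel \<and> sets N = sets borel \<and>
     (\<exists>P\<in>sets borel. emeasure M (- P) = 0 \<and> emeasure N P = 0) \<and>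
     (\<forall>B\<in>sets borel. \<nu> B = measure M B - measure N B)"

definition has_signed_integral ::
    "(real set \<Rightarrow> real) \<Rightarrow> (real \<Rightarrow> real) \<Rightarrow> real \<Rightarrow> bool" where
  "has_signed_integral \<nu> f I \<longleftrightarrow>
     (\<exists>M N. jordan_decomposition \<nu> M N \<and> integrable M f \<and> integrable N f \<and>
        I = integral\<^sup>L M f - integral\<^sup>L N f)"

definition matrix_measure :: "(real set \<Rightarrow> real^'p^'p) \<Rightarrow> bool" where
  "matrix_measure \<mu> \<longleftrightarrow>
     (\<forall>i j. finite_signed_measure (\<lambda>B. \<mu> B $ i $ j)) \<and>
     (\<forall>B\<in>sets borel. psd_on UNIV (\<lambda>i j. \<mu> B $ i $ j))"

definition hamburger_moment_sequence :: "(nat \<Rightarrow> real^'p^'p) \<Rightarrow> bool" where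
  "hamburger_moment_sequence S \<longleftrightarrow>
     (\<exists>\<mu>. matrix_measure \<mu> \<and>
        (\<forall>k i j. has_signed_integral (\<lambda>B. \<mu> B $ i $ j) (\<lambda>x. x ^ k) (S k $ i $ j)))"

section \<open>Well-definedness\<close>

text \<open>The minimal polynomial of a linearly recursive sequence exists and is unique.\<close>

lemma module_smult: "module (smult :: real \<Rightarrow> real poly \<Rightarrow> real poly)"
  by unfold_locales (simp_all add: smult_add_right smult_add_left)

lemma characteristic_poly_iff:
  fixes S :: "nat \<Rightarrow> real^'p^'p"
  shows "P \<in> characteristic_polys S \<longleftrightarrow>
     degree P \<ge> 1 \<and> lead_coeff P = 1 \<and> coeff P 0 \<noteq> 0 \<and>
     (\<forall>n. (\<Sum>i\<le>degree P. coeff P i *\<^sub>R S (n + i)) = 0)" (is "?L \<longleftrightarrow> ?R")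
proof -
  have key: "degree (monom 1 m - (\<Sum>i<m. monom (a i) (m - 1 - i))) = m \<and>
     (\<forall>k<m. coeff (monom 1 m - (\<Sum>i<m. monom (a i) (m - 1 - i))) k = - a (m - 1 - k)) \<and>
     coeff (monom 1 m - (\<Sum>i<m. monom (a i) (m - 1 - i))) m = 1"
    if "m \<ge> 1" for m :: nat and a :: "nat \<Rightarrow> real"
  proof -
    let ?P = "monom 1 m - (\<Sum>i<m. monom (a i) (m - 1 - i))"
    have c: "coeff ?P k = (if k = m then 1 else if k < m then - a (m - 1 - k) else 0)" for k
    proof -
      have "coeff (\<Sum>i<m. monom (a i) (m - 1 - i)) k = (\<Sum>i<m. if m - 1 - i = k then a i else 0)"
        by (simp add: coeff_sum)
      also have "\<dots> = (\<Sum>i<m. if k < m \<and> i = m - 1 - k then a i else 0)"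
        by (intro sum.cong) auto
      also have "\<dots> = (if k < m then a (m - 1 - k) else 0)"
        using that by (cases "k < m") auto
      finally show ?thesis by auto
    qed
    have "degree ?P = m"
      by (intro antisym degree_le le_degree) (auto simp only: c, auto)
    then show ?thesis by (simp only: c) auto
  qed
  have rec: "(\<forall>n\<ge>m - 1. S (n + 1) = (\<Sum>i<m. a i *\<^sub>R S (n - i))) \<longleftrightarrow>
     (\<forall>n. S (n + m) - (\<Sum>i<m. a (m - 1 - i) *\<^sub>R S (n + i)) = 0)" (is "?A \<longleftrightarrow> ?B")
    if "m \<ge> 1" for m :: nat and a :: "nat \<Rightarrow> real"
  proof -
    have eq: "(\<Sum>i<m. a (m - 1 - i) *\<^sub>R S (n + i)) = (\<Sum>i<m. a i *\<^sub>R S (n + (m - 1) - i))" for n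
    proof -
      have idx: "n + (m - 1) - (m - 1 - i) = n + i" if "i < m" for i using that by linarith
      have "(\<Sum>i<m. a (m - 1 - i) *\<^sub>R S (n + i)) =
          (\<Sum>i<m. a (m - 1 - i) *\<^sub>R S (n + (m - 1) - (m - 1 - i)))"
        by (intro sum.cong refl) (simp only: idx lessThan_iff)
      then show ?thesis
        using sum.nat_diff_reindex[of "\<lambda>i. a i *\<^sub>R S (n + (m - 1) - i)" m] by simp
    qed
    have "?A \<longleftrightarrow> (\<forall>n. S (n + (m - 1) + 1) = (\<Sum>i<m. a i *\<^sub>R S (n + (m - 1) - i)))"
    proof (intro iffI allI impI)
      fix n assume ?A
      then show "S (n + (m - 1) + 1) = (\<Sum>i<m. a i *\<^sub>R S (n + (m - 1) - i))" by simp
    next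
      fix n assume *: "\<forall>n. S (n + (m - 1) + 1) = (\<Sum>i<m. a i *\<^sub>R S (n + (m - 1) - i))"
        and "m - 1 \<le> n"
      from *[rule_format, of "n - (m - 1)"]
      show "S (n + 1) = (\<Sum>i<m. a i *\<^sub>R S (n - i))"
        by (simp only: le_add_diff_inverse2[OF \<open>m - 1 \<le> n\<close>])
    qed
    also have "\<dots> \<longleftrightarrow> ?B" unfolding eq using that by simp
    finally show ?thesis .
  qed
  show ?thesis
  proof
    assume ?L
    then obtain m a where P: "P = monom 1 m - (\<Sum>i<m. monom (a i) (m - 1 - i))"
      and s: "satisfies_recurrence S m a"
      unfolding characteristic_polys_def by blast
    from s have m: "m \<ge> 1" "a (m - 1) \<noteq> 0" by (auto simp: satisfies_recurrence_def)
    note k = key[OF m(1), of a, folded P]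
    have B: "S (n + m) - (\<Sum>i<m. a (m - 1 - i) *\<^sub>R S (n + i)) = 0" for n
      using s rec[OF m(1), of a] by (simp add: satisfies_recurrence_def)
    have "(\<Sum>i\<le>degree P. coeff P i *\<^sub>R S (n + i)) = 0" for n
    proof -
      have "(\<Sum>i<m. coeff P i *\<^sub>R S (n + i)) = - (\<Sum>i<m. a (m - 1 - i) *\<^sub>R S (n + i))"
        unfolding sum_negf[symmetric] using k by (intro sum.cong) auto
      then show ?thesis using B[of n] k by (simp add: lessThan_Suc_atMost[symmetric])
    qed
    then show ?R using k m by auto
  next
    assume R: ?R
    define m a where "m = degree P" and "a = (\<lambda>i. - coeff P (m - 1 - i))"
    have m: "m \<ge> 1" using R by (simp add: m_def)
    note k = key[OF m, of a]
    have P: "P = monom 1 m - (\<Sum>i<m. monom (a i) (m - 1 - i))"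
    proof (rule poly_eqI)
      fix i
      consider "i < m" | "i = m" | "i > m" by linarith
      then show "coeff P i = coeff (monom 1 m - (\<Sum>i<m. monom (a i) (m - 1 - i))) i"
      proof cases
        case 1 then show ?thesis using k by (auto simp: a_def)
      next
        case 2 then show ?thesis using k R m_def by auto
      next
        case 3 then show ?thesis using k m_def by (metis coeff_eq_0)
      qed
    qed
    have "S (n + m) - (\<Sum>i<m. a (m - 1 - i) *\<^sub>R S (n + i)) = 0" for n
    proof -
      have "(\<Sum>i<m. coeff P i *\<^sub>R S (n + i)) = - (\<Sum>i<m. a (m - 1 - i) *\<^sub>R S (n + i))"
        unfolding sum_negf[symmetric] by (intro sum.cong) (auto simp: a_def)
      moreover have "(\<Sum>i\<le>m. coeff P i *\<^sub>R S (n + i)) = 0" using R m_def by auto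
      moreover have "coeff P m = 1" using R m_def by auto
      ultimately show ?thesis by (simp add: lessThan_Suc_atMost[symmetric])
    qed
    then have "satisfies_recurrence S m a"
      unfolding satisfies_recurrence_def rec[OF m, of a] using m R by (simp add: a_def)
    with P show ?L unfolding characteristic_polys_def by blast
  qed
qed

lemma ex1_minimal_poly:
  fixes S :: "nat \<Rightarrow> real^'p^'p"
  assumes "linearly_recursive S"
  shows "\<exists>!P. is_minimal_poly S P"
proof -
  interpret m: module "smult :: real \<Rightarrow> real poly \<Rightarrow> real poly" by (rule module_smult)
  let ?I = "m.span (characteristic_polys S)"
  obtain P0 where P0: "P0 \<in> characteristic_polys S"
    using assms unfolding linearly_recursive_def characteristic_polys_def by blast
  have mult1: "[:c, 1:] * P \<in> characteristic_polys S"
    if P: "P \<in> characteristic_polys S" and "c \<noteq> 0" for P c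
  proof -
    have P': "degree P \<ge> 1" "lead_coeff P = 1" "coeff P 0 \<noteq> 0"
        "\<And>n. (\<Sum>i\<le>degree P. coeff P i *\<^sub>R S (n + i)) = 0"
      using P unfolding characteristic_poly_iff by auto
    then have "P \<noteq> 0" by auto
    then have deg: "degree ([:c, 1:] * P) = Suc (degree P)"
      by (subst degree_mult_eq) auto
    have co: "coeff ([:c, 1:] * P) i = c * coeff P i + (case i of 0 \<Rightarrow> 0 | Suc j \<Rightarrow> coeff P j)" for i
      by (simp add: coeff_pCons split: nat.split)
    have "(\<Sum>i\<le>Suc (degree P). coeff ([:c, 1:] * P) i *\<^sub>R S (n + i)) = 0" for n
    proof -
      have "(\<Sum>i\<le>Suc (degree P). coeff ([:c, 1:] * P) i *\<^sub>R S (n + i)) =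
         c *\<^sub>R (\<Sum>i\<le>Suc (degree P). coeff P i *\<^sub>R S (n + i)) +
         (\<Sum>i\<le>Suc (degree P). (case i of 0 \<Rightarrow> 0 | Suc j \<Rightarrow> coeff P j) *\<^sub>R S (n + i))"
        unfolding co by (simp only: scaleR_add_left sum.distrib scaleR_sum_right scaleR_scaleR)
      also have "(\<Sum>i\<le>Suc (degree P). coeff P i *\<^sub>R S (n + i)) = 0"
        using P'(4)[of n] by (simp add: coeff_eq_0)
      also have "(\<Sum>i\<le>Suc (degree P). (case i of 0 \<Rightarrow> 0 | Suc j \<Rightarrow> coeff P j) *\<^sub>R S (n + i)) =
          (\<Sum>i\<le>degree P. coeff P i *\<^sub>R S (Suc n + i))"
        by (subst sum.atMost_Suc_shift) simp
      also have "\<dots> = 0" by (rule P'(4))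
      finally show ?thesis by simp
    qed
    moreover have "coeff ([:c, 1:] * P) (Suc (degree P)) = 1"
      using P'(2) unfolding co by (simp add: coeff_eq_0)
    moreover have "coeff ([:c, 1:] * P) 0 \<noteq> 0" using P'(3) \<open>c \<noteq> 0\<close> unfolding co by simp
    ultimately show ?thesis unfolding characteristic_poly_iff deg by auto
  qed
  have multX: "[:0, 1:] * Q \<in> ?I" if "Q \<in> ?I" for Q
    using that
  proof (induction rule: m.span_induct_alt)
    case base then show ?case by (simp add: m.span_zero)
  next
    case (step c P Q)
    have "[:0, 1:] * P = [:1, 1:] * P - P" by simp
    then have "[:0, 1:] * P \<in> ?I"
      using mult1[OF step(1), of 1] step(1) by (metis m.span_base m.span_diff zero_neq_one)
    then have "smult c ([:0, 1:] * P) + [:0, 1:] * Q \<in> ?I"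
      using step by (intro m.span_add m.span_scale)
    then show ?case by (simp add: smult_add_right)
  qed
  have mult: "R * Q \<in> ?I" if "Q \<in> ?I" for R Q
  proof (induction R)
    case 0 then show ?case by (simp add: m.span_zero)
  next
    case (pCons a R)
    have "pCons a R * Q = smult a Q + [:0, 1:] * (R * Q)" by simp
    then show ?case using multX[OF pCons(2)] that by (metis m.span_add m.span_scale)
  qed
  have "P0 \<in> ?I \<and> P0 \<noteq> 0"
    using P0 m.span_base[of P0] by (auto simp: characteristic_poly_iff)
  then obtain P where P: "P \<in> ?I" "P \<noteq> 0" and
    least: "\<And>Q. Q \<in> ?I \<Longrightarrow> Q \<noteq> 0 \<Longrightarrow> degree P \<le> degree Q"
    using ex_has_least_nat[of "\<lambda>Q. Q \<in> ?I \<and> Q \<noteq> 0" P0 degree] by blast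
  define D where "D = smult (inverse (lead_coeff P)) P"
  have D: "D \<in> ?I" "lead_coeff D = 1" "degree D = degree P"
    using P by (auto simp: D_def intro: m.span_scale)
  have "?I = {Q. D dvd Q}"
  proof (intro set_eqI iffI; clarsimp)
    fix Q assume Q: "Q \<in> ?I"
    have "Q mod D = Q - (Q div D) * D" by (simp add: minus_div_mult_eq_mod)
    then have "Q mod D \<in> ?I" using Q mult[OF D(1)] by (metis m.span_diff)
    moreover have "D \<noteq> 0" using D(2) by auto
    ultimately have "Q mod D = 0"
      using least[of "Q mod D"] degree_mod_less[of D Q] D(3) by linarith
    then show "D dvd Q" by auto
  next
    fix Q assume "D dvd Q"
    then show "Q \<in> ?I" using mult[OF D(1)] by (metis dvdE mult.commute)
  qed
  then have "is_minimal_poly S D" using D(2) by (simp add: is_minimal_poly_def)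
  moreover have "A = B" if "is_minimal_poly S A" "is_minimal_poly S B" for A B
  proof -
    have dvd: "A dvd B" "B dvd A" and lc: "lead_coeff A = 1" "lead_coeff B = 1"
      using that unfolding is_minimal_poly_def by auto
    then obtain k where k: "B = A * k" by blast
    have nz: "A \<noteq> 0" "B \<noteq> 0" using lc by auto
    then have "k \<noteq> 0" using k by auto
    then have "degree B = degree A + degree k" using k nz(1) by (simp add: degree_mult_eq)
    moreover have "degree B \<le> degree A" using dvd(2) nz(1) by (rule dvd_imp_degree_le)
    ultimately obtain c where c: "k = [:c:]" by (metis add_le_same_cancel1 degree_eq_zeroE le_zero_eq)
    have "lead_coeff B = lead_coeff A * lead_coeff k" unfolding k by (rule lead_coeff_mult)
    then have "c = 1" using lc c by simp
    then show ?thesis using k c by simp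
  qed
  ultimately show ?thesis by blast
qed

lemma is_minimal_poly_minimal_poly:
  "linearly_recursive S \<Longrightarrow> is_minimal_poly S (minimal_poly S)"
  unfolding minimal_poly_def by (rule theI') (rule ex1_minimal_poly)

text \<open>The Jordan decomposition, hence the integral against a signed measure, is unique.\<close>

lemma jordan_decomposition_unique:
  assumes "jordan_decomposition \<nu> M N" "jordan_decomposition \<nu> M' N'"
  shows "M = M' \<and> N = N'"
proof -
  have le: "measure M B \<le> measure M' B"
    if J: "jordan_decomposition \<nu> M N" "jordan_decomposition \<nu> M' N'" and B: "B \<in> sets borel"
    for M N M' N' B
  proof -
    from J interpret M: finite_measure M by (simp add: jordan_decomposition_def)
    from J interpret M': finite_measure M' by (simp add: jordan_decomposition_def)
    have s: "sets M = sets borel" "sets N = sets borel" "sets M' = sets borel"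
      and nu: "\<And>B. B \<in> sets borel \<Longrightarrow> \<nu> B = measure M B - measure N B"
        "\<And>B. B \<in> sets borel \<Longrightarrow> \<nu> B = measure M' B - measure N' B"
      using J by (auto simp: jordan_decomposition_def)
    obtain P where P: "P \<in> sets borel" "emeasure M (- P) = 0" "emeasure N P = 0"
      using J by (auto simp: jordan_decomposition_def)
    have BP: "B \<inter> P \<in> sets borel" "B - P \<in> sets borel" using B P by auto
    have "emeasure M (B - P) = 0" "emeasure N (B \<inter> P) = 0"
      using P s by (auto intro: emeasure_eq_0)
    then have z: "measure M (B - P) = 0" "measure N (B \<inter> P) = 0" by (simp_all add: measure_def)
    have "measure M B = measure M (B \<inter> P) + measure M (B - P)"
      using M.finite_measure_Union[of "B \<inter> P" "B - P"] BP s by (simp add: Int_Diff_disjoint Int_Diff_Un)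
    also have "\<dots> = \<nu> (B \<inter> P)" using nu(1)[OF BP(1)] z by simp
    also have "\<dots> \<le> measure M' (B \<inter> P)" using nu(2)[OF BP(1)] by simp
    also have "\<dots> \<le> measure M' B" using B s by (intro M'.finite_measure_mono) auto
    finally show ?thesis .
  qed
  have eq: "measure M B = measure M' B" if "B \<in> sets borel" for B
    using le[OF assms that] le[OF assms(2,1) that] by simp
  have eq': "measure N B = measure N' B" if "B \<in> sets borel" for B
    using eq[OF that] assms that unfolding jordan_decomposition_def by fastforce
  have fin: "finite_measure M" "finite_measure M'" "finite_measure N" "finite_measure N'"
    and s: "sets M = sets borel" "sets M' = sets borel" "sets N = sets borel" "sets N' = sets borel"
    using assms by (simp_all add: jordan_decomposition_def)
  have "M = M'"
    by (rule measure_eqI) (simp_all only: s eq fin finite_measure.emeasure_eq_measure)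
  moreover have "N = N'"
    by (rule measure_eqI) (simp_all only: s eq' fin finite_measure.emeasure_eq_measure)
  ultimately show ?thesis ..
qed

lemma has_signed_integral_unique:
  "has_signed_integral \<nu> f I \<Longrightarrow> has_signed_integral \<nu> f J \<Longrightarrow> I = J"
  unfolding has_signed_integral_def by (auto dest: jordan_decomposition_unique)

end

theory Submission
  imports Defs "HOL-Computational_Algebra.Fundamental_Theorem_Algebra"
begin

text \<open>
  If the roots \<open>x\<close> of the minimal polynomial are real and simple, Lagrange interpolation at them
  gives \<open>S n = (\<Sum>x. x ^ n *\<^sub>R W x)\<close>, where \<open>W x\<close> is the value at the Lagrange polynomial \<open>l\<close> of
  \<open>x\<close> of the functional that sends \<open>X ^ n\<close> to \<open>S n\<close>. This functional annihilates the ideal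
  generated by the minimal polynomial, and \<open>l ^ 2\<close> is congruent to \<open>l\<close> modulo it, so \<open>v\<^sup>T (W x) v\<close>
  is a value of the quadratic form of the Hankel matrix. Hence the atomic measure with masses
  \<open>W x\<close> represents \<open>S\<close> as soon as the Hankel matrix is positive semidefinite.

  Conversely, when the integrand \<open>x ^ k\<close> is replaced by \<open>u(x) ^ k\<close> for a simple function \<open>u\<close>,
  the Hankel form becomes a finite sum of values of the forms \<open>\<mu> B\<close>; then let \<open>u\<close> tend to
  the identity.
\<close>

section \<open>Polynomials acting on sequences by the shift\<close>

text \<open>This is \<open>Q(E) S\<close> for the shift operator \<open>E\<close>. At
  \<open>n = 0\<close> it is the value at \<open>Q\<close> of the linear functional sending
  \<open>X ^ k\<close> to \<open>S k\<close>; keeping \<open>n\<close> free makes the result a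
  sequence again, on which a further polynomial can act.\<close>

definition shift_poly :: "(nat \<Rightarrow> 'a::real_vector) \<Rightarrow> real poly \<Rightarrow> nat \<Rightarrow> 'a" where
  "shift_poly S Q n = (\<Sum>i\<le>degree Q. coeff Q i *\<^sub>R S (n + i))"

lemma shift_poly_eq_sum:
  assumes "degree Q \<le> d"
  shows "shift_poly S Q n = (\<Sum>i\<le>d. coeff Q i *\<^sub>R S (n + i))"
  unfolding shift_poly_def
  by (rule sum.mono_neutral_left) (use assms in \<open>auto simp: coeff_eq_0\<close>)

lemma shift_poly_0 [simp]: "shift_poly S 0 n = 0"
  by (simp add: shift_poly_def)

lemma shift_poly_add: "shift_poly S (P + Q) n = shift_poly S P n + shift_poly S Q n"
proof -
  let ?d = "max (degree P) (degree Q)"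
  have "degree (P + Q) \<le> ?d" by (rule degree_add_le_max)
  then show ?thesis
    by (simp add: shift_poly_eq_sum[where d = ?d] scaleR_add_left sum.distrib)
qed

lemma shift_poly_smult: "shift_poly S (smult c P) n = c *\<^sub>R shift_poly S P n"
  by (simp add: shift_poly_eq_sum[where d = "degree P"] degree_smult_le scaleR_sum_right)

lemma shift_poly_diff: "shift_poly S (P - Q) n = shift_poly S P n - shift_poly S Q n"
proof -
  have "P - Q = P + smult (-1) Q" by simp
  then show ?thesis by (simp only: shift_poly_add shift_poly_smult) simp
qed

lemma shift_poly_sum: "shift_poly S (\<Sum>i\<in>I. f i) n = (\<Sum>i\<in>I. shift_poly S (f i) n)"
  by (induction I rule: infinite_finite_induct) (auto simp: shift_poly_add)

lemma shift_poly_monom: "shift_poly S (monom c k) n = c *\<^sub>R S (n + k)"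
proof -
  have "shift_poly S (monom c k) n = (\<Sum>i\<le>k. if i = k then c *\<^sub>R S (n + i) else 0)"
    unfolding shift_poly_eq_sum[OF degree_monom_le] by (intro sum.cong) auto
  then show ?thesis by simp
qed

lemma shift_poly_pCons: "shift_poly S (pCons a Q) n = a *\<^sub>R S n + shift_poly S Q (Suc n)"
  by (subst shift_poly_eq_sum[where d = "Suc (degree Q)"])
     (simp_all add: degree_pCons_le sum.atMost_Suc_shift shift_poly_def del: sum.atMost_Suc)

text \<open>Multiplication by \<open>X\<close> moves the base point to \<open>Suc n\<close>, so the
  induction on \<open>P\<close> has to generalize \<open>n\<close>. Products of polynomials thereby
  become compositions of actions.\<close>

lemma shift_poly_mult: "shift_poly S (P * Q) n = shift_poly (shift_poly S Q) P n"
  by (induction P arbitrary: n)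
     (simp_all add: shift_poly_add shift_poly_smult shift_poly_pCons)

text \<open>The link to Hankel matrices: letting the two factors act in turn produces the Hankel
  form at the coefficient vector of \<open>Q\<close>. Any \<open>d\<close> bounding the degree is
  allowed, so that the size of the matrix can be fixed in advance.\<close>

lemma shift_poly_square:
  assumes "degree Q \<le> d"
  shows "shift_poly S (Q * Q) 0 = (\<Sum>a\<le>d. \<Sum>b\<le>d. (coeff Q a * coeff Q b) *\<^sub>R S (a + b))"
  unfolding shift_poly_mult shift_poly_eq_sum[OF assms] by (simp add: scaleR_sum_right)

text \<open>Annihilating polynomials form an ideal: in \<open>Q = R * P\<close> the factor
  \<open>P\<close> acts first and leaves the zero sequence.\<close>

lemma shift_poly_eq_0_dvd:
  assumes "P dvd Q" "\<And>n. shift_poly S P n = 0"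
  shows "shift_poly S Q n = 0"
proof -
  obtain R where "Q = R * P" using assms(1) by (metis dvdE mult.commute)
  then have "shift_poly S Q n = shift_poly (shift_poly S P) R n" by (simp add: shift_poly_mult)
  also have "\<dots> = 0" by (simp add: shift_poly_def[of "shift_poly S P"] assms(2))
  finally show ?thesis .
qed

text \<open>Characteristic polynomials annihilate \<open>S\<close> by
  \<open>characteristic_poly_iff\<close>, and annihilation is linear. This reaches the minimal
  polynomial, which lies in the span that it generates.\<close>

lemma shift_poly_span_characteristic_polys:
  assumes "Q \<in> module.span smult (characteristic_polys S)"
  shows "shift_poly S Q n = 0"
proof -
  interpret m: module "smult :: real \<Rightarrow> real poly \<Rightarrow> real poly" by (rule module_smult)
  from assms show ?thesis
    by (induction rule: m.span_induct_alt)
       (auto simp: shift_poly_add shift_poly_smult characteristic_poly_iff shift_poly_def[symmetric])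
qed

section \<open>Interpolation at simple real roots\<close>

lemma poly_map_poly_of_real:
  "poly (map_poly of_real P) (of_real x :: complex) = of_real (poly P x)"
  by (induction P) (simp_all add: map_poly_pCons)

text \<open>Over the complex numbers a monic polynomial is the product of its linear factors with
  multiplicity. Here every root is real and every multiplicity is 1.\<close>

lemma real_distinct_roots_prod:
  fixes P :: "real poly"
  assumes "lead_coeff P = 1" "real_distinct_roots P"
  shows "P = (\<Prod>x | poly P x = 0. [:- x, 1:])"
proof -
  let ?Q = "map_poly of_real P :: complex poly"
  have lc: "lead_coeff ?Q = 1"
    using assms(1) by (simp add: coeff_map_poly degree_map_poly)
  have roots: "{z. poly ?Q z = 0} = of_real ` {x. poly P x = 0}"
    using assms(2) by (fastforce simp: real_distinct_roots_def poly_map_poly_of_real elim!: Reals_cases)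
  have "?Q = (\<Prod>z | poly ?Q z = 0. [:- z, 1:] ^ order z ?Q)"
    using complex_poly_decompose[of ?Q] lc by simp
  also have "\<dots> = (\<Prod>z | poly ?Q z = 0. [:- z, 1:])"
    using assms(2) by (intro prod.cong) (auto simp: real_distinct_roots_def)
  also have "\<dots> = (\<Prod>x | poly P x = 0. [:- of_real x, 1:])"
    unfolding roots by (subst prod.reindex) (auto simp: inj_on_def)
  finally have eq: "?Q = (\<Prod>x | poly P x = 0. [:- of_real x, 1:])" .
  \<comment> \<open>The factorization descends to the reals by comparing values at real points,
    since a real polynomial is determined by them.\<close>
  have "poly P y = poly (\<Prod>x | poly P x = 0. [:- x, 1:]) y" for y
  proof -
    have "complex_of_real (poly P y) = (\<Prod>x | poly P x = 0. of_real y - of_real x)"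
      unfolding poly_map_poly_of_real[symmetric] by (subst eq) (simp add: poly_prod)
    also have "\<dots> = of_real (poly (\<Prod>x | poly P x = 0. [:- x, 1:]) y)"
      by (simp add: poly_prod)
    finally show ?thesis by (simp only: of_real_eq_iff)
  qed
  then show ?thesis by (intro ext iffD1[OF poly_eq_poly_eq_iff])
qed

definition lagrange_poly :: "real set \<Rightarrow> real \<Rightarrow> real poly" where
  "lagrange_poly R x =
     smult (inverse (\<Prod>y\<in>R - {x}. x - y)) (\<Prod>y\<in>R - {x}. [:- y, 1:])"

lemma poly_lagrange_poly:
  assumes "finite R" "x \<in> R" "z \<in> R"
  shows "poly (lagrange_poly R x) z = (if z = x then 1 else 0)"
  using assms by (auto simp: lagrange_poly_def poly_prod)

text \<open>This bound decides the size of the Hankel matrix: with \<open>r\<close> roots, blocks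
  \<open>0\<close> to \<open>r - 1\<close> suffice.\<close>

lemma degree_lagrange_poly:
  assumes "finite R" "x \<in> R"
  shows "degree (lagrange_poly R x) \<le> card R - 1"
proof -
  have "degree (\<Prod>y\<in>R - {x}. [:- y, 1:]) = card R - 1"
    using assms by (subst degree_prod_sum_eq) auto
  then show ?thesis unfolding lagrange_poly_def by (metis degree_smult_le)
qed

text \<open>Linear factors are split off one at a time. The product over the earlier points does not
  vanish at the new point \<open>y\<close>, so the cofactor has to.\<close>

lemma prod_linear_dvd:
  fixes Q :: "real poly"
  assumes "finite R" "\<And>x. x \<in> R \<Longrightarrow> poly Q x = 0"
  shows "(\<Prod>x\<in>R. [:- x, 1:]) dvd Q"
  using assms
proof (induction R)
  case (insert y R)
  then obtain K where K: "Q = (\<Prod>x\<in>R. [:- x, 1:]) * K" by (auto elim: dvdE)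
  have "poly (\<Prod>x\<in>R. [:- x, 1:]) y \<noteq> 0" using insert by (auto simp: poly_prod)
  then have "poly K y = 0" using insert.prems[of y] K by simp
  then obtain L where "K = [:- y, 1:] * L" by (auto simp: poly_eq_0_iff_dvd elim: dvdE)
  then have "Q = (\<Prod>x\<in>insert y R. [:- x, 1:]) * L"
    using K by (simp only: prod.insert[OF insert.hyps(1,2)] mult_ac)
  then show ?case by (rule dvdI)
qed simp

section \<open>Atomic representing measures\<close>

lemma jordan_decomposition_imp_finite_signed_measure:
  assumes "jordan_decomposition \<nu> M N"
  shows "finite_signed_measure \<nu>"
proof -
  have J: "finite_measure M" "finite_measure N" "sets M = sets borel" "sets N = sets borel"
    and nu: "\<And>B. B \<in> sets borel \<Longrightarrow> \<nu> B = measure M B - measure N B"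
    using assms by (auto simp: jordan_decomposition_def)
  interpret M: finite_measure M by fact
  interpret N: finite_measure N by fact
  have "(\<lambda>n. \<nu> (A n)) sums \<nu> (\<Union>n. A n)"
    if A: "range A \<subseteq> sets borel" "disjoint_family A" for A :: "nat \<Rightarrow> real set"
  proof -
    have eq: "\<nu> (A n) = measure M (A n) - measure N (A n)" for n
      using A(1) by (intro nu) auto
    have eq': "\<nu> (\<Union>n. A n) = measure M (\<Union>n. A n) - measure N (\<Union>n. A n)"
      using A(1) by (intro nu) auto
    show ?thesis
      unfolding eq eq' using A J
      by (intro sums_diff M.finite_measure_UNION N.finite_measure_UNION) auto
  qed
  moreover have "\<nu> {} = 0" by (simp add: nu)
  ultimately show ?thesis by (simp add: finite_signed_measure_def)
qed

text \<open>Truncation at 0 keeps the positive part of the weights, so \<open>w\<close> and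
  \<open>- w\<close> yield the two halves of a Jordan decomposition. The pushforward along the
  identity replaces the power set of \<open>R\<close> by the Borel sets of the line.\<close>

definition atomic_measure :: "real set \<Rightarrow> (real \<Rightarrow> real) \<Rightarrow> real measure" where
  "atomic_measure R w = distr (point_measure R (\<lambda>x. ennreal (max 0 (w x)))) borel (\<lambda>x. x)"

lemma sets_atomic_measure [simp]: "sets (atomic_measure R w) = sets borel"
  by (simp add: atomic_measure_def)

lemma emeasure_atomic_measure:
  assumes "finite R" "B \<in> sets borel"
  shows "emeasure (atomic_measure R w) B = ennreal (\<Sum>x\<in>R \<inter> B. max 0 (w x))"
proof -
  have "emeasure (atomic_measure R w) B =
      emeasure (point_measure R (\<lambda>x. ennreal (max 0 (w x)))) (R \<inter> B)"
    using assms unfolding atomic_measure_def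
    by (subst emeasure_distr) (auto simp: space_point_measure Int_commute)
  also have "\<dots> = (\<Sum>x\<in>R \<inter> B. ennreal (max 0 (w x)))"
    using assms by (intro emeasure_point_measure_finite) auto
  finally show ?thesis by (simp add: sum_ennreal)
qed

lemma measure_atomic_measure:
  assumes "finite R" "B \<in> sets borel"
  shows "measure (atomic_measure R w) B = (\<Sum>x\<in>R \<inter> B. max 0 (w x))"
  using assms by (simp add: measure_def emeasure_atomic_measure sum_nonneg)

lemma finite_measure_atomic_measure:
  assumes "finite R"
  shows "finite_measure (atomic_measure R w)"
  using assms
  by (intro finite_measureI) (simp add: emeasure_atomic_measure atomic_measure_def[symmetric]
      sets_eq_imp_space_eq[OF sets_atomic_measure])

lemma atomic_measure_integral:
  fixes f :: "real \<Rightarrow> real"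
  assumes "finite R" "f \<in> borel_measurable borel"
  shows "integrable (atomic_measure R w) f"
    and "integral\<^sup>L (atomic_measure R w) f = (\<Sum>x\<in>R. max 0 (w x) * f x)"
proof -
  have [measurable]: "(\<lambda>x. x) \<in> measurable (point_measure R g) borel" for g :: "real \<Rightarrow> ennreal"
    by (simp add: measurable_def space_point_measure sets_point_measure)
  show "integrable (atomic_measure R w) f"
    unfolding atomic_measure_def using assms
    by (subst integrable_distr_eq) (auto intro: integrable_point_measure_finite)
  show "integral\<^sup>L (atomic_measure R w) f = (\<Sum>x\<in>R. max 0 (w x) * f x)"
    unfolding atomic_measure_def using assms
    by (subst integral_distr) (auto simp: lebesgue_integral_point_measure_finite)
qed

lemma jordan_decomposition_atomic:
  assumes "finite R"
  shows "jordan_decomposition (\<lambda>B. \<Sum>x\<in>R. indicator B x * w x)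
           (atomic_measure R w) (atomic_measure R (\<lambda>x. - w x))"
proof -
  \<comment> \<open>A Hahn set: the first measure lives on the points of positive weight, the second
    on points outside them.\<close>
  define P where "P = {x \<in> R. w x > 0}"
  have P: "P \<in> sets borel" using assms by (simp add: P_def finite_imp_closed)
  have "emeasure (atomic_measure R w) (- P) = 0"
    using assms P borel_comp[OF P] by (subst emeasure_atomic_measure) (auto simp: P_def intro!: ennreal_eq_0_iff[THEN iffD2] sum_nonpos)
  moreover have "emeasure (atomic_measure R (\<lambda>x. - w x)) P = 0"
    using assms P by (subst emeasure_atomic_measure) (auto simp: P_def intro!: sum.neutral)
  moreover have "(\<Sum>x\<in>R. indicator B x * w x) =
      measure (atomic_measure R w) B - measure (atomic_measure R (\<lambda>x. - w x)) B"
    if "B \<in> sets borel" for B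
  proof -
    have "(\<Sum>x\<in>R. indicator B x * w x) = (\<Sum>x\<in>R \<inter> B. w x)"
      using assms by (intro sum.mono_neutral_cong_right) (auto simp: indicator_def)
    also have "\<dots> = (\<Sum>x\<in>R \<inter> B. max 0 (w x) - max 0 (- w x))"
      by (intro sum.cong) auto
    finally show ?thesis using assms that by (simp add: measure_atomic_measure sum_subtractf)
  qed
  ultimately show ?thesis
    using assms P by (auto simp: jordan_decomposition_def finite_measure_atomic_measure)
qed

lemma has_signed_integral_atomic:
  assumes "finite R" "f \<in> borel_measurable borel"
  shows "has_signed_integral (\<lambda>B. \<Sum>x\<in>R. indicator B x * w x) f (\<Sum>x\<in>R. w x * f x)"
proof -
  have "(\<Sum>x\<in>R. w x * f x) = (\<Sum>x\<in>R. (max 0 (w x) - max 0 (- w x)) * f x)"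
    by (intro sum.cong) auto
  also have "\<dots> = integral\<^sup>L (atomic_measure R w) f - integral\<^sup>L (atomic_measure R (\<lambda>x. - w x)) f"
    using assms by (simp add: atomic_measure_integral left_diff_distrib sum_subtractf)
  finally show ?thesis
    unfolding has_signed_integral_def
    using jordan_decomposition_atomic atomic_measure_integral(1) assms by blast
qed

text \<open>The quadratic form is linear in the matrix. With indicators as coefficients this covers
  the values of an atomic matrix measure.\<close>

lemma psd_on_combination:
  fixes W :: "'a \<Rightarrow> real^'p^'p"
  assumes "\<And>x. x \<in> R \<Longrightarrow> psd_on UNIV (\<lambda>i j. W x $ i $ j)" "\<And>x. x \<in> R \<Longrightarrow> 0 \<le> c x"
  shows "psd_on UNIV (\<lambda>i j. (\<Sum>x\<in>R. c x *\<^sub>R W x) $ i $ j)"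
proof -
  have "(\<Sum>x\<in>R. c x *\<^sub>R W x) $ i $ j = (\<Sum>x\<in>R. c x *\<^sub>R W x) $ j $ i" for i j
    using assms(1) by (auto simp: psd_on_def intro!: sum.cong)
  moreover have "0 \<le> (\<Sum>i\<in>UNIV. \<Sum>j\<in>UNIV. v i * (\<Sum>x\<in>R. c x *\<^sub>R W x) $ i $ j * v j)" for v
  proof -
    have "(\<Sum>i\<in>UNIV. \<Sum>j\<in>UNIV. v i * (\<Sum>x\<in>R. c x *\<^sub>R W x) $ i $ j * v j) =
        (\<Sum>i\<in>UNIV. \<Sum>j\<in>UNIV. \<Sum>x\<in>R. c x * (v i * W x $ i $ j * v j))"
      by (simp add: sum_distrib_left sum_distrib_right mult_ac)
    also have "\<dots> = (\<Sum>i\<in>UNIV. \<Sum>x\<in>R. \<Sum>j\<in>UNIV. c x * (v i * W x $ i $ j * v j))"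
      by (intro sum.cong refl sum.swap)
    also have "\<dots> = (\<Sum>x\<in>R. c x * (\<Sum>i\<in>UNIV. \<Sum>j\<in>UNIV. v i * W x $ i $ j * v j))"
      by (subst sum.swap) (simp add: sum_distrib_left)
    also have "\<dots> \<ge> 0"
      using assms unfolding psd_on_def by (intro sum_nonneg[of R] mult_nonneg_nonneg) blast+
    finally show ?thesis .
  qed
  ultimately show ?thesis by (simp add: psd_on_def)
qed

lemma hamburger_moment_sequence_atomic:
  fixes W :: "real \<Rightarrow> real^'p^'p"
  assumes "finite R" "\<And>x. x \<in> R \<Longrightarrow> psd_on UNIV (\<lambda>i j. W x $ i $ j)"
    and S: "\<And>n. S n = (\<Sum>x\<in>R. x ^ n *\<^sub>R W x)"
  shows "hamburger_moment_sequence S"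
proof -
  define \<mu> where "\<mu> = (\<lambda>B. \<Sum>x\<in>R. indicator B x *\<^sub>R W x)"
  have entry: "(\<lambda>B. \<mu> B $ i $ j) = (\<lambda>B. \<Sum>x\<in>R. indicator B x * (W x $ i $ j))" for i j
    by (simp add: \<mu>_def)
  have "matrix_measure \<mu>"
    unfolding matrix_measure_def
  proof (intro conjI allI ballI)
    show "finite_signed_measure (\<lambda>B. \<mu> B $ i $ j)" for i j
      unfolding entry using jordan_decomposition_atomic[OF assms(1)]
      by (rule jordan_decomposition_imp_finite_signed_measure)
    show "psd_on UNIV (\<lambda>i j. \<mu> B $ i $ j)" for B
      unfolding \<mu>_def using assms(2) by (intro psd_on_combination) auto
  qed
  moreover have "has_signed_integral (\<lambda>B. \<mu> B $ i $ j) (\<lambda>x. x ^ k) (S k $ i $ j)" for k i j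
    using has_signed_integral_atomic[OF assms(1), of "\<lambda>x. x ^ k" "\<lambda>x. W x $ i $ j"]
    unfolding entry S by (simp add: mult.commute)
  ultimately show ?thesis unfolding hamburger_moment_sequence_def by blast
qed

section \<open>Positivity of Hankel forms\<close>

text \<open>The integral is written through the values of \<open>M\<close> on the fibres of
  \<open>u\<close>, so that subtracting two such formulas leaves only the signed measure.\<close>

lemma integral_simple_function_power:
  fixes u :: "real \<Rightarrow> real"
  assumes "finite_measure M" "sets M = sets borel" "simple_function borel u"
  shows "integral\<^sup>L M (\<lambda>x. u x ^ k) = (\<Sum>c\<in>range u. c ^ k * measure M (u -` {c}))"
proof -
  interpret finite_measure M by fact
  have fin: "finite (range u)" and vim: "u -` {c} \<in> sets M" for c
    using assms(2,3) simple_functionD[of borel u] by auto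
  have "u x ^ k = (\<Sum>c\<in>range u. c ^ k * indicator (u -` {c}) x)" for x
  proof -
    have "(\<Sum>c\<in>range u. c ^ k * indicator (u -` {c}) x) = (\<Sum>c\<in>range u. if c = u x then c ^ k else 0)"
      by (intro sum.cong) (auto simp: indicator_def)
    then show ?thesis using fin by simp
  qed
  then have "integral\<^sup>L M (\<lambda>x. u x ^ k) =
      integral\<^sup>L M (\<lambda>x. \<Sum>c\<in>range u. c ^ k * indicator (u -` {c}) x)"
    by presburger
  also have "\<dots> = (\<Sum>c\<in>range u. c ^ k * measure M (u -` {c}))"
    using vim sets.sets_into_space[OF vim]
    by (subst Bochner_Integration.integral_sum) (auto simp: Int_absorb2 less_top[symmetric])
  finally show ?thesis .
qed

text \<open>Dominated convergence with the majorant
  \<open>2 ^ k * \<bar>x ^ k\<bar>\<close>.\<close>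

lemma tendsto_integral_power:
  fixes u :: "nat \<Rightarrow> real \<Rightarrow> real"
  assumes "sets M = sets borel" "integrable M (\<lambda>x. x ^ k)"
    and "\<And>n. u n \<in> borel_measurable borel" "\<And>x. (\<lambda>n. u n x) \<longlonglongrightarrow> x"
    and "\<And>n x. \<bar>u n x\<bar> \<le> 2 * \<bar>x\<bar>"
  shows "(\<lambda>n. integral\<^sup>L M (\<lambda>x. u n x ^ k)) \<longlonglongrightarrow> integral\<^sup>L M (\<lambda>x. x ^ k)"
proof (rule integral_dominated_convergence)
  show "integrable M (\<lambda>x. 2 ^ k * \<bar>x ^ k\<bar>)" using assms(2) by simp
  show "(\<lambda>x. u n x ^ k) \<in> borel_measurable M" for n
    using assms(1,3) by (intro borel_measurable_power) (simp cong: measurable_cong_sets)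
  show "AE x in M. norm (u n x ^ k) \<le> 2 ^ k * \<bar>x ^ k\<bar>" for n
    using power_mono[OF assms(5)] by (simp add: power_abs power_mult_distrib)
  show "AE x in M. (\<lambda>n. u n x ^ k) \<longlonglongrightarrow> x ^ k"
    using tendsto_power[OF assms(4)] by simp
qed (use assms(2) in auto)

text \<open>Both Jordan parts are approximated along the same \<open>u\<close>, so the decomposition
  disappears from the finite sums. Entries of a matrix measure with different Jordan decompositions
  can then share one partition of the line.\<close>

lemma has_signed_integral_power_approx:
  fixes u :: "nat \<Rightarrow> real \<Rightarrow> real"
  assumes "has_signed_integral \<nu> (\<lambda>x. x ^ k) I"
    and "\<And>n. simple_function borel (u n)" "\<And>x. (\<lambda>n. u n x) \<longlonglongrightarrow> x"
    and "\<And>n x. \<bar>u n x\<bar> \<le> 2 * \<bar>x\<bar>"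
  shows "(\<lambda>n. \<Sum>c\<in>range (u n). c ^ k * \<nu> (u n -` {c})) \<longlonglongrightarrow> I"
proof -
  obtain M N where J: "jordan_decomposition \<nu> M N"
    and int: "integrable M (\<lambda>x. x ^ k)" "integrable N (\<lambda>x. x ^ k)"
    and I: "I = integral\<^sup>L M (\<lambda>x. x ^ k) - integral\<^sup>L N (\<lambda>x. x ^ k)"
    using assms(1) unfolding has_signed_integral_def by blast
  have fin: "finite_measure M" "finite_measure N" and s: "sets M = sets borel" "sets N = sets borel"
    using J by (auto simp: jordan_decomposition_def)
  have meas: "u n \<in> borel_measurable borel" for n
    using assms(2) by (rule borel_measurable_simple_function)
  have "(\<lambda>n. integral\<^sup>L M (\<lambda>x. u n x ^ k) - integral\<^sup>L N (\<lambda>x. u n x ^ k)) \<longlonglongrightarrow> I"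
    unfolding I using s int meas assms(3,4) by (intro tendsto_diff tendsto_integral_power) auto
  moreover have "integral\<^sup>L M (\<lambda>x. u n x ^ k) - integral\<^sup>L N (\<lambda>x. u n x ^ k) =
      (\<Sum>c\<in>range (u n). c ^ k * \<nu> (u n -` {c}))" for n
  proof -
    have "\<nu> (u n -` {c}) = measure M (u n -` {c}) - measure N (u n -` {c})" for c
      using J simple_functionD(2)[OF assms(2)[of n], of "{c}"] by (simp add: jordan_decomposition_def)
    then show ?thesis
      using fin s assms(2)
      by (simp add: integral_simple_function_power right_diff_distrib sum_subtractf)
  qed
  ultimately show ?thesis by simp
qed

text \<open>The factor 2 comes from the general approximation theorem, which controls the distance
  to a base point, here 0, up to that factor.\<close>

lemma simple_approx_id:
  obtains u :: "nat \<Rightarrow> real \<Rightarrow> real"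
  where "\<And>n. simple_function borel (u n)" "\<And>x. (\<lambda>n. u n x) \<longlonglongrightarrow> x"
    and "\<And>n x. \<bar>u n x\<bar> \<le> 2 * \<bar>x\<bar>"
  using borel_measurable_implies_sequence_metric[of "\<lambda>x::real. x" borel 0]
  by (auto simp: dist_real_def)

lemma hamburger_imp_psd_block_hankel:
  fixes S :: "nat \<Rightarrow> real^'p^'p"
  assumes "hamburger_moment_sequence S"
  shows "psd_on ({0..d} \<times> UNIV) (block_hankel S)"
proof -
  obtain \<mu> where \<mu>: "matrix_measure \<mu>"
    and int: "\<And>k i j. has_signed_integral (\<lambda>B. \<mu> B $ i $ j) (\<lambda>x. x ^ k) (S k $ i $ j)"
    using assms unfolding hamburger_moment_sequence_def by blast
  obtain u :: "nat \<Rightarrow> real \<Rightarrow> real" where u: "\<And>n. simple_function borel (u n)"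
    "\<And>x. (\<lambda>n. u n x) \<longlonglongrightarrow> x" "\<And>n x. \<bar>u n x\<bar> \<le> 2 * \<bar>x\<bar>"
    using simple_approx_id by blast
  \<comment> \<open>The moments of the image of \<open>\<mu>\<close> under \<open>u n\<close>, a
    matrix measure with finitely many atoms.\<close>
  define s where "s = (\<lambda>n k. \<Sum>c\<in>range (u n). c ^ k *\<^sub>R \<mu> (u n -` {c}))"
  have lim: "(\<lambda>n. s n k $ i $ j) \<longlonglongrightarrow> S k $ i $ j" for k i j
    using has_signed_integral_power_approx[OF int u] by (simp add: s_def)
  have psd: "psd_on UNIV (\<lambda>i j. \<mu> (u n -` {c}) $ i $ j)" for n c
    using \<mu> simple_functionD(2)[OF u(1)[of n], of "{c}"] by (simp add: matrix_measure_def)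
  have "s n k $ i $ j = s n k $ j $ i" for n k i j
    using psd by (auto simp: s_def psd_on_def intro!: sum.cong)
  then have sym: "S k $ i $ j = S k $ j $ i" for k i j
    using LIMSEQ_unique[OF lim[of k i j]] lim[of k j i] by simp
  have "0 \<le> (\<Sum>a\<in>{0..d} \<times> UNIV. \<Sum>b\<in>{0..d} \<times> UNIV. v a * block_hankel S a b * v b)" for v
  proof (rule tendsto_lowerbound)
    show "(\<lambda>n. \<Sum>a\<in>{0..d} \<times> UNIV. \<Sum>b\<in>{0..d} \<times> UNIV. v a * block_hankel (s n) a b * v b)
        \<longlonglongrightarrow> (\<Sum>a\<in>{0..d} \<times> UNIV. \<Sum>b\<in>{0..d} \<times> UNIV. v a * block_hankel S a b * v b)"
      by (auto simp: block_hankel_def split: prod.split intro!: tendsto_intros lim)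
    have "0 \<le> (\<Sum>a\<in>{0..d} \<times> UNIV. \<Sum>b\<in>{0..d} \<times> UNIV. v a * block_hankel (s n) a b * v b)" for n
    proof -
      let ?m = "\<lambda>c i j. \<mu> (u n -` {c}) $ i $ j"
      \<comment> \<open>Since \<open>c ^ (a + b) = c ^ a * c ^ b\<close>, summing over the block
        indices with these weights collapses the Hankel form at the atom \<open>c\<close> to the
        form of a single matrix at the vector \<open>y c\<close>.\<close>
      define y where "y = (\<lambda>c i. \<Sum>a\<in>{0..d}. c ^ a * v (a, i))"
      have "(\<Sum>a\<in>{0..d} \<times> UNIV. \<Sum>b\<in>{0..d} \<times> UNIV. v a * block_hankel (s n) a b * v b) =
         (\<Sum>a\<in>{0..d}. \<Sum>i\<in>UNIV. \<Sum>b\<in>{0..d}. \<Sum>j\<in>UNIV. \<Sum>c\<in>range (u n).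
            (c ^ a * v (a, i)) * ?m c i j * (c ^ b * v (b, j)))"
        by (simp add: sum.cartesian_product' block_hankel_def s_def sum_distrib_left
            sum_distrib_right power_add mult_ac)
      also have "\<dots> = (\<Sum>c\<in>range (u n). \<Sum>a\<in>{0..d}. \<Sum>i\<in>UNIV. \<Sum>b\<in>{0..d}. \<Sum>j\<in>UNIV.
            (c ^ a * v (a, i)) * ?m c i j * (c ^ b * v (b, j)))"
        \<comment> \<open>Fixing the inner index set lets the rewriting move only the sum over the
          atoms outwards, past all the others.\<close>
        by (simp only: sum.swap[of _ "range (u n)"])
      also have "\<dots> = (\<Sum>c\<in>range (u n). \<Sum>i\<in>UNIV. \<Sum>j\<in>UNIV. y c i * ?m c i j * y c j)"
      proof (intro sum.cong refl)
        fix c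
        have "(\<Sum>a\<in>{0..d}. \<Sum>i\<in>UNIV. \<Sum>b\<in>{0..d}. \<Sum>j\<in>UNIV.
              (c ^ a * v (a, i)) * ?m c i j * (c ^ b * v (b, j))) =
            (\<Sum>i\<in>UNIV. \<Sum>a\<in>{0..d}. \<Sum>j\<in>UNIV. \<Sum>b\<in>{0..d}.
              (c ^ a * v (a, i)) * ?m c i j * (c ^ b * v (b, j)))"
          by (subst sum.swap) (intro sum.cong refl sum.swap)
        also have "\<dots> = (\<Sum>i\<in>UNIV. \<Sum>j\<in>UNIV. \<Sum>a\<in>{0..d}. \<Sum>b\<in>{0..d}.
              (c ^ a * v (a, i)) * ?m c i j * (c ^ b * v (b, j)))"
          by (intro sum.cong refl sum.swap)
        also have "\<dots> = (\<Sum>i\<in>UNIV. \<Sum>j\<in>UNIV. y c i * ?m c i j * y c j)"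
          by (simp add: y_def sum_distrib_left sum_distrib_right)
             (rule sum.cong[OF refl], rule sum.cong[OF refl], rule sum.swap)
        finally show "(\<Sum>a\<in>{0..d}. \<Sum>i\<in>UNIV. \<Sum>b\<in>{0..d}. \<Sum>j\<in>UNIV.
              (c ^ a * v (a, i)) * ?m c i j * (c ^ b * v (b, j))) = \<dots>" .
      qed
      also have "\<dots> \<ge> 0" using psd unfolding psd_on_def by (intro sum_nonneg[of "range (u n)"]) blast
      finally show ?thesis .
    qed
    then show "\<forall>\<^sub>F n in sequentially.
        0 \<le> (\<Sum>a\<in>{0..d} \<times> UNIV. \<Sum>b\<in>{0..d} \<times> UNIV. v a * block_hankel (s n) a b * v b)"
      by simp
  qed simp
  moreover have "block_hankel S a b = block_hankel S b a" for a b
    using sym by (auto simp: block_hankel_def add.commute split: prod.split)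
  ultimately show ?thesis by (simp add: psd_on_def)
qed

lemma psd_shift_poly_square:
  fixes S :: "nat \<Rightarrow> real^'p^'p"
  assumes H: "psd_on ({0..d} \<times> UNIV) (block_hankel S)" and Q: "degree Q \<le> d"
  shows "psd_on UNIV (\<lambda>i j. shift_poly S (Q * Q) 0 $ i $ j)"
proof -
  note sq = shift_poly_square[OF Q, of S]
  have "S (a + b) $ i $ j = S (a + b) $ j $ i" if "a \<le> d" "b \<le> d" for a b i j
  proof -
    have "block_hankel S (a, i) (b, j) = block_hankel S (b, j) (a, i)"
      using H that by (auto simp: psd_on_def)
    then show ?thesis by (simp add: block_hankel_def add.commute)
  qed
  then have "shift_poly S (Q * Q) 0 $ i $ j = shift_poly S (Q * Q) 0 $ j $ i" for i j
    unfolding sq by (auto intro!: sum.cong)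
  moreover have "0 \<le> (\<Sum>i\<in>UNIV. \<Sum>j\<in>UNIV. v i * shift_poly S (Q * Q) 0 $ i $ j * v j)" for v
  proof -
    \<comment> \<open>The tensor product of the coefficient vector of \<open>Q\<close> with
      \<open>v\<close>; the Hankel form at this vector is the form to be bounded.\<close>
    define x where "x = (\<lambda>(a, i). coeff Q a * v i)"
    have "0 \<le> (\<Sum>a\<in>{0..d} \<times> UNIV. \<Sum>b\<in>{0..d} \<times> UNIV. x a * block_hankel S a b * x b)"
      using H by (simp add: psd_on_def)
    also have "\<dots> = (\<Sum>a\<in>{0..d}. \<Sum>i\<in>UNIV. \<Sum>b\<in>{0..d}. \<Sum>j\<in>UNIV.
        v i * (coeff Q a * coeff Q b * S (a + b) $ i $ j) * v j)"
      by (simp add: sum.cartesian_product' block_hankel_def x_def mult_ac)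
    also have "\<dots> = (\<Sum>i\<in>UNIV. \<Sum>a\<in>{0..d}. \<Sum>j\<in>UNIV. \<Sum>b\<in>{0..d}.
        v i * (coeff Q a * coeff Q b * S (a + b) $ i $ j) * v j)"
      by (subst sum.swap) (intro sum.cong refl sum.swap)
    also have "\<dots> = (\<Sum>i\<in>UNIV. \<Sum>j\<in>UNIV. \<Sum>a\<in>{0..d}. \<Sum>b\<in>{0..d}.
        v i * (coeff Q a * coeff Q b * S (a + b) $ i $ j) * v j)"
      by (intro sum.cong refl sum.swap)
    also have "\<dots> = (\<Sum>i\<in>UNIV. \<Sum>j\<in>UNIV. v i * shift_poly S (Q * Q) 0 $ i $ j * v j)"
      unfolding sq by (simp add: sum_distrib_left sum_distrib_right atMost_atLeast0)
    finally show ?thesis .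
  qed
  ultimately show ?thesis by (simp add: psd_on_def)
qed

theorem theorem4p1:
  fixes S :: "nat \<Rightarrow> real^'p^'p" and r :: nat
  assumes "r \<ge> 1"
    and "linearly_recursive S"
    and "has_order S r"
    and "real_distinct_roots (minimal_poly S)"
  shows "hamburger_moment_sequence S \<longleftrightarrow> psd_on ({0..r - 1} \<times> UNIV) (block_hankel S)"
proof
  assume "hamburger_moment_sequence S"
  then show "psd_on ({0..r - 1} \<times> UNIV) (block_hankel S)"
    by (rule hamburger_imp_psd_block_hankel)
next
  assume H: "psd_on ({0..r - 1} \<times> UNIV) (block_hankel S)"
  define P where "P = minimal_poly S"
  define R where "R = {x. poly P x = 0}"
  have "is_minimal_poly S P"
    unfolding P_def using assms(2) by (rule is_minimal_poly_minimal_poly)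
  then have lc: "lead_coeff P = 1" and "P \<in> module.span smult (characteristic_polys S)"
    by (auto simp: is_minimal_poly_def)
  then have ann: "shift_poly S P n = 0" for n
    by (intro shift_poly_span_characteristic_polys)
  have "P \<noteq> 0" using lc by auto
  then have fin: "finite R" unfolding R_def by (rule poly_roots_finite)
  have P: "P = (\<Prod>x\<in>R. [:- x, 1:])"
    unfolding R_def using lc assms(4) by (intro real_distinct_roots_prod) (simp_all add: P_def)
  then have "degree P = card R" by (simp add: degree_prod_sum_eq)
  then have r: "card R = r" using assms(3) by (simp add: has_order_def P_def)
  \<comment> \<open>The functional depends only on the values of a polynomial on \<open>R\<close>:
    one that vanishes there is a multiple of \<open>P\<close>.\<close>
  have vanish: "shift_poly S Q n = 0" if "\<And>x. x \<in> R \<Longrightarrow> poly Q x = 0" for Q n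
    using prod_linear_dvd[OF fin that] ann unfolding P[symmetric] by (rule shift_poly_eq_0_dvd)
  define L where "L = lagrange_poly R"
  have L: "poly (L x) z = (if z = x then 1 else 0)" if "x \<in> R" "z \<in> R" for x z
    unfolding L_def using fin that by (rule poly_lagrange_poly)
  define W where "W = (\<lambda>x. shift_poly S (L x) 0)"
  have "psd_on UNIV (\<lambda>i j. W x $ i $ j)" if x: "x \<in> R" for x
  proof -
    \<comment> \<open>On \<open>R\<close> the polynomial \<open>L x\<close> takes only the values 0
      and 1, so it agrees there with its square.\<close>
    have "shift_poly S (L x * L x - L x) 0 = 0" by (rule vanish) (simp add: L x)
    then have "W x = shift_poly S (L x * L x) 0" by (simp add: W_def shift_poly_diff)
    then show ?thesis
      using psd_shift_poly_square[OF H, of "L x"] degree_lagrange_poly[OF fin x] r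
      by (simp add: L_def)
  qed
  moreover have "S n = (\<Sum>x\<in>R. x ^ n *\<^sub>R W x)" for n
  proof -
    \<comment> \<open>The interpolant of \<open>X ^ n\<close> at the roots agrees with
      \<open>X ^ n\<close> on \<open>R\<close>, so the functional gives both the same value.\<close>
    have "poly (\<Sum>x\<in>R. smult (x ^ n) (L x)) z = z ^ n" if "z \<in> R" for z
    proof -
      have "poly (\<Sum>x\<in>R. smult (x ^ n) (L x)) z = (\<Sum>x\<in>R. if x = z then x ^ n else 0)"
        using that by (auto simp: poly_sum L intro!: sum.cong)
      then show ?thesis using fin that by simp
    qed
    then have "shift_poly S (monom 1 n - (\<Sum>x\<in>R. smult (x ^ n) (L x))) 0 = 0"
      by (intro vanish) (simp add: poly_monom)
    then show ?thesis
      by (simp add: shift_poly_diff shift_poly_sum shift_poly_smult shift_poly_monom W_def)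
  qed
  ultimately show "hamburger_moment_sequence S"
    using fin by (intro hamburger_moment_sequence_atomic[of R W])
qed

end
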